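(* Let $c\ge 0$, $\phi\in[0,1]$, $A\in\mathbb{R}$, and let $P$ be a real random variable with $\mathbb{E}[P^+]<\infty$ having a density $f$ that is strictly positive above $c$ (i.e. $f(p)>0$ for all $p>c$). For $K\ge 0$ define $$\underline I(K)=\begin{cases}\mathbb{E}[(P-c)^+]-A, & K\le c,\\[4pt] (1-\phi)\,\mathbb{E}[(P-c)^+]+\phi\,\mathbb{E}[(P-K)^+]-A, & K>c.\end{cases}$$ Then $\underline I(K)$ is constant for $K\le c$ and weakly decreasing for $K>c$. Furthermore, exactly one of the following holds: 1. $\underline I(K)<0$ for all $K\ge 0$ (the certificate does not establish incentive compatibility at any strike price). 2. $\underline I(K)\ge 0$ for all $K\ge 0$; in this case the resource is incentive-compatible at every strike price $K \ge 0$. 3. There exists a unique threshold $\kappa\ge c$ satisfying $\underline I(\kappa)=0$; in this case the resource is incentive-compatible for every $K\le\kappa$ (with $K \ge 0$). This case can occur only if $\phi>0$.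
   Context: Notation: $(x)^+=\max\{x,0\}$. $P$ is the real-time price, with distribution function $F$; $c$, $A$, $\phi$ are the marginal cost, preparation cost, and price-impact bound of a fixed resource in a fixed hour; $K$ is the strike price. Incentive compatibility: let $P_w$, with distribution function $F_w$, denote the counterfactual price when the resource becomes available. It is a standing assumption that $F_w(p)=F(p)$ for $p<c$ and $(1-\phi)(1-F(p))\le 1-F_w(p)\le 1-F(p)$ for $p\ge c$. The incentive value is $$I(K)=\mathbb{E}[(P_w-c)^+]-\mathbb{E}[(P_w-K)^+]+\mathbb{E}[(P-K)^+]-A,$$ and the resource is incentive-compatible at $K$ if $I(K)\ge 0$. The function $\underline I$ is called the conservative incentive certificate. *)

theory Defs
  imports "HOL-Probability.Probability"
begin

definition expected_excess :: "'a measure \<Rightarrow> ('a \<Rightarrow> real) \<Rightarrow> real \<Rightarrow> real" where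
  "expected_excess M X k = (\<integral>\<omega>. max (X \<omega> - k) 0 \<partial>M)"

definition conservative_certificate ::
    "'a measure \<Rightarrow> real \<Rightarrow> real \<Rightarrow> real \<Rightarrow> ('a \<Rightarrow> real) \<Rightarrow> real \<Rightarrow> real" where
  "conservative_certificate M c A \<phi> P K =
    (if K \<le> c then expected_excess M P c - A
     else (1 - \<phi>) * expected_excess M P c + \<phi> * expected_excess M P K - A)"

definition distribution_function :: "'a measure \<Rightarrow> ('a \<Rightarrow> real) \<Rightarrow> real \<Rightarrow> real" where
  "distribution_function M X = cdf (distr M borel X)"

(* Integrability of the positive part of Pw is not demanded here: it follows from that of P and
   the upper bound on the tail of Pw, so the Bochner integrals below are genuine expectations. *)
definition counterfactual_price ::
    "'a measure \<Rightarrow> real \<Rightarrow> real \<Rightarrow> ('a \<Rightarrow> real) \<Rightarrow> ('a \<Rightarrow> real) \<Rightarrow> bool" where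
  "counterfactual_price M c \<phi> P Pw \<longleftrightarrow>
    Pw \<in> borel_measurable M \<and>
    (\<forall>p<c. distribution_function M Pw p = distribution_function M P p) \<and>
    (\<forall>p\<ge>c. (1 - \<phi>) * (1 - distribution_function M P p) \<le> 1 - distribution_function M Pw p \<and>
           1 - distribution_function M Pw p \<le> 1 - distribution_function M P p)"

definition incentive_value ::
    "'a measure \<Rightarrow> real \<Rightarrow> real \<Rightarrow> ('a \<Rightarrow> real) \<Rightarrow> ('a \<Rightarrow> real) \<Rightarrow> real \<Rightarrow> real" where
  "incentive_value M c A P Pw K =
    expected_excess M Pw c - expected_excess M Pw K + expected_excess M P K - A"

definition incentive_compatible ::
    "'a measure \<Rightarrow> real \<Rightarrow> real \<Rightarrow> ('a \<Rightarrow> real) \<Rightarrow> ('a \<Rightarrow> real) \<Rightarrow> real \<Rightarrow> bool" where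
  "incentive_compatible M c A P Pw K \<longleftrightarrow> incentive_value M c A P Pw K \<ge> 0"

end

theory Submission
  imports Defs
begin

text \<open>Write \<open>H K = E (P - K)\<^sup>+\<close>. For \<open>K \<ge> c\<close> the certificate is
  \<open>(1 - \<phi>) * H c + \<phi> * H K - A\<close>, and for \<open>K \<le> c\<close> it keeps the value it has at \<open>c\<close>. Its shape is
  thus the shape of \<open>H\<close>: always Lipschitz and decreasing, and strictly decreasing on \<open>{c..}\<close>,
  because the positive density gives every tail beyond \<open>c\<close> a positive probability. If \<open>\<phi> = 0\<close> the
  certificate is constant and its sign decides between the first two cases. If \<open>\<phi> > 0\<close>, a
  certificate that takes both signs crosses zero exactly once on \<open>{c..}\<close>.

  The certificate is a lower bound for the incentive value. Both are compared through the identity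
  \<open>E (X - a)\<^sup>+ - E (X - b)\<^sup>+ = \<integral>\<^bsub>a\<^esub>\<^bsup>b\<^esup> P(X > p) dp\<close> for \<open>a \<le> b\<close>, which turns the
  hypotheses on the distribution function of the counterfactual price into inequalities between
  expectations (\<open>expected_excess_difference_mono_tail\<close>). The same identity with \<open>b = \<infinity>\<close>
  transfers integrability from \<open>P\<close> to \<open>Pw\<close> (\<open>integrable_excess_of_tail_le\<close>).\<close>

section \<open>Tails and expected excesses\<close>

lemma (in prob_space) prob_greater_eq_one_minus_distribution_function:
  assumes [measurable]: "X \<in> borel_measurable M"
  shows "prob {\<omega> \<in> space M. p < X \<omega>} = 1 - distribution_function M X p"
proof -
  have "prob {\<omega> \<in> space M. \<not> X \<omega> \<le> p} = 1 - prob {\<omega> \<in> space M. X \<omega> \<le> p}"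
    by (rule prob_neg) measurable
  moreover have "distribution_function M X p = prob {\<omega> \<in> space M. X \<omega> \<le> p}"
    by (simp add: distribution_function_def cdf_def measure_distr vimage_def Int_def conj_commute)
  ultimately show ?thesis
    by (simp add: not_le)
qed

text \<open>The layer-cake formula, localised to a set \<open>S\<close> of price levels: both sides measure
  the part of the region below the graph of \<open>X\<close> whose height lies in \<open>S\<close>, once by vertical
  and once by horizontal sections. The values are extended nonnegative reals, so the formula is
  available before anything is known about integrability.\<close>

lemma (in prob_space) nn_integral_truncated_length_eq_tail:
  fixes X :: "'a \<Rightarrow> real"
  assumes [measurable]: "X \<in> borel_measurable M" "S \<in> sets borel"
  shows "(\<integral>\<^sup>+\<omega>. emeasure lborel (S \<inter> {..<X \<omega>}) \<partial>M)
    = (\<integral>\<^sup>+p\<in>S. ennreal (1 - distribution_function M X p) \<partial>lborel)"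
proof -
  interpret pair_sigma_finite M lborel
    by unfold_locales
  have "(\<integral>\<^sup>+\<omega>. emeasure lborel (S \<inter> {..<X \<omega>}) \<partial>M)
    = (\<integral>\<^sup>+\<omega>. \<integral>\<^sup>+p. indicator S p * indicator {q. q < X \<omega>} p \<partial>lborel \<partial>M)"
    by (intro nn_integral_cong)
      (simp add: nn_integral_indicator[symmetric] indicator_inter_arith lessThan_def
        del: nn_integral_indicator)
  also have "\<dots> = (\<integral>\<^sup>+\<omega>. \<integral>\<^sup>+p. indicator S p * indicator {\<omega>\<in>space M. p < X \<omega>} \<omega> \<partial>lborel \<partial>M)"
    by (intro nn_integral_cong) (auto simp: indicator_def)
  also have "\<dots> = (\<integral>\<^sup>+p. \<integral>\<^sup>+\<omega>. indicator S p * indicator {\<omega>\<in>space M. p < X \<omega>} \<omega> \<partial>M \<partial>lborel)"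
    by (rule Fubini'[symmetric]) measurable
  also have "\<dots> = (\<integral>\<^sup>+p. indicator S p * emeasure M {\<omega>\<in>space M. p < X \<omega>} \<partial>lborel)"
    by (intro nn_integral_cong) (simp add: nn_integral_cmult)
  also have "\<dots> = (\<integral>\<^sup>+p\<in>S. ennreal (1 - distribution_function M X p) \<partial>lborel)"
    by (intro nn_integral_cong)
      (simp add: emeasure_eq_measure prob_greater_eq_one_minus_distribution_function mult.commute)
  finally show ?thesis .
qed

text \<open>The factor \<open>\<alpha>\<close> is there for the lower incentive bound on the counterfactual price, where it
  is \<open>1 - \<phi>\<close>; with \<open>\<alpha> = 1\<close> this is the usual comparison of stochastically ordered variables.\<close>

lemma (in prob_space) nn_integral_truncated_length_mono_tail:
  fixes X Y :: "'a \<Rightarrow> real"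
  assumes [measurable]: "X \<in> borel_measurable M" "Y \<in> borel_measurable M" "S \<in> sets borel"
    and "0 \<le> \<alpha>"
    and tail: "\<And>p. p \<in> S \<Longrightarrow>
      \<alpha> * (1 - distribution_function M X p) \<le> 1 - distribution_function M Y p"
  shows "ennreal \<alpha> * (\<integral>\<^sup>+\<omega>. emeasure lborel (S \<inter> {..<X \<omega>}) \<partial>M)
    \<le> (\<integral>\<^sup>+\<omega>. emeasure lborel (S \<inter> {..<Y \<omega>}) \<partial>M)"
proof -
  have [measurable]: "distribution_function M X \<in> borel_measurable borel"
  proof (rule borel_measurable_mono)
    interpret D: finite_measure "distr M borel X"
      by (rule finite_measure_distr) simp
    show "mono (distribution_function M X)"
      unfolding distribution_function_def mono_def cdf_def
      by (auto intro!: D.finite_measure_mono)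
  qed
  have "ennreal \<alpha> * (\<integral>\<^sup>+p\<in>S. ennreal (1 - distribution_function M X p) \<partial>lborel)
    = (\<integral>\<^sup>+p. ennreal \<alpha> * (ennreal (1 - distribution_function M X p) * indicator S p) \<partial>lborel)"
    by (rule nn_integral_cmult[symmetric]) measurable
  also have "\<dots> \<le> (\<integral>\<^sup>+p\<in>S. ennreal (1 - distribution_function M Y p) \<partial>lborel)"
    using tail \<open>0 \<le> \<alpha>\<close>
    by (intro nn_integral_mono) (auto simp: indicator_def ennreal_mult'[symmetric] intro!: ennreal_leI)
  finally show ?thesis
    by (simp add: nn_integral_truncated_length_eq_tail)
qed

lemma (in prob_space) integrable_excess_shift:
  assumes int: "integrable M (\<lambda>\<omega>. max (X \<omega> - k) (0::real))"
    and [measurable]: "X \<in> borel_measurable M"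
  shows "integrable M (\<lambda>\<omega>. max (X \<omega> - l) 0)"
proof (rule Bochner_Integration.integrable_bound)
  show "integrable M (\<lambda>\<omega>. max (X \<omega> - k) 0 + \<bar>k - l\<bar>)"
    using int by simp
  show "AE \<omega> in M. norm (max (X \<omega> - l) 0) \<le> norm (max (X \<omega> - k) 0 + \<bar>k - l\<bar>)"
    by (intro AE_I2) auto
qed measurable

lemma (in prob_space) integrable_excess_of_tail_le:
  fixes X Y :: "'a \<Rightarrow> real"
  assumes [measurable]: "X \<in> borel_measurable M" "Y \<in> borel_measurable M"
    and int: "integrable M (\<lambda>\<omega>. max (X \<omega> - c) 0)"
    and tail: "\<And>p. c \<le> p \<Longrightarrow> 1 - distribution_function M Y p \<le> 1 - distribution_function M X p"
  shows "integrable M (\<lambda>\<omega>. max (Y \<omega> - k) 0)"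
proof -
  have length: "emeasure lborel ({c..} \<inter> {..<x}) = ennreal (max (x - c) 0)" for x :: real
  proof -
    have "{c..} \<inter> {..<x} = {c..<x}" by auto
    then show ?thesis by (cases "c \<le> x") (simp_all add: max_def)
  qed
  have "(\<integral>\<^sup>+\<omega>. ennreal (max (Y \<omega> - c) 0) \<partial>M) \<le> (\<integral>\<^sup>+\<omega>. ennreal (max (X \<omega> - c) 0) \<partial>M)"
    using nn_integral_truncated_length_mono_tail[of Y X "{c..}" 1] tail
    by (simp add: length)
  also have "\<dots> < \<infinity>"
    using int by (simp add: integrable_iff_bounded)
  finally have "integrable M (\<lambda>\<omega>. max (Y \<omega> - c) 0)"
    by (simp add: integrable_iff_bounded)
  then show ?thesis
    by (rule integrable_excess_shift) measurable
qed

lemma (in prob_space) expected_excess_difference_eq: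
  assumes "\<And>k. integrable M (\<lambda>\<omega>. max (X \<omega> - k) (0::real))"
  shows "expected_excess M X a - expected_excess M X b
    = expectation (\<lambda>\<omega>. max (X \<omega> - a) 0 - max (X \<omega> - b) 0)"
  using assms by (simp add: expected_excess_def)

text \<open>A difference of two excesses is the length of the slice of \<open>{a..<b}\<close> below \<open>X\<close>, so only
  tails at levels between the two strikes matter.\<close>

lemma (in prob_space) expected_excess_difference_mono_tail:
  fixes X Y :: "'a \<Rightarrow> real"
  assumes meas: "X \<in> borel_measurable M" "Y \<in> borel_measurable M"
    and int: "\<And>k. integrable M (\<lambda>\<omega>. max (X \<omega> - k) 0)" "\<And>k. integrable M (\<lambda>\<omega>. max (Y \<omega> - k) 0)"
    and "a \<le> b" "0 \<le> \<alpha>"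
    and tail: "\<And>p. a \<le> p \<Longrightarrow> p < b \<Longrightarrow>
      \<alpha> * (1 - distribution_function M X p) \<le> 1 - distribution_function M Y p"
  shows "\<alpha> * (expected_excess M X a - expected_excess M X b)
    \<le> expected_excess M Y a - expected_excess M Y b"
proof -
  have length: "emeasure lborel ({a..<b} \<inter> {..<x}) = ennreal (max (x - a) 0 - max (x - b) 0)" for x
  proof -
    have "{a..<b} \<inter> {..<x} = {a..<min b x}" by auto
    then show ?thesis
      using \<open>a \<le> b\<close> by (cases "a \<le> x") (auto simp: max_def min_def)
  qed
  have slice: "(\<integral>\<^sup>+\<omega>. emeasure lborel ({a..<b} \<inter> {..<Z \<omega>}) \<partial>M)
      = ennreal (expected_excess M Z a - expected_excess M Z b)"
    and nonneg: "0 \<le> expected_excess M Z a - expected_excess M Z b"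
    if "\<And>k. integrable M (\<lambda>\<omega>. max (Z \<omega> - k) 0)" for Z
    unfolding length expected_excess_difference_eq[OF that]
    using that \<open>a \<le> b\<close>
    by (intro nn_integral_eq_integral Bochner_Integration.integrable_diff
          Bochner_Integration.integral_nonneg AE_I2; simp)+
  have "ennreal (\<alpha> * (expected_excess M X a - expected_excess M X b))
      \<le> ennreal (expected_excess M Y a - expected_excess M Y b)"
    using nn_integral_truncated_length_mono_tail[OF meas, of "{a..<b}" \<alpha>] tail \<open>0 \<le> \<alpha>\<close>
    by (simp add: slice int ennreal_mult')
  then show ?thesis
    using nonneg[OF int(2)] by (simp add: ennreal_le_iff)
qed

section \<open>The expected excess as a function of the strike\<close>

lemma (in prob_space) expected_excess_antimono:
  assumes "\<And>k. integrable M (\<lambda>\<omega>. max (X \<omega> - k) (0::real))" and "a \<le> b"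
  shows "expected_excess M X b \<le> expected_excess M X a"
  unfolding expected_excess_def using assms by (intro integral_mono) auto

text \<open>The two excesses differ exactly where \<open>X\<close> exceeds the smaller strike, so equal expectations
  would make that tail a null set.\<close>

lemma (in prob_space) expected_excess_strict_antimono:
  fixes X :: "'a \<Rightarrow> real"
  assumes [measurable]: "X \<in> borel_measurable M"
    and int: "\<And>k. integrable M (\<lambda>\<omega>. max (X \<omega> - k) 0)"
    and "a < b"
    and tail: "emeasure M {\<omega> \<in> space M. a < X \<omega>} \<noteq> 0"
  shows "expected_excess M X b < expected_excess M X a"
proof (rule ccontr)
  assume "\<not> ?thesis"
  with expected_excess_antimono[OF int, of a b] \<open>a < b\<close>
  have "expectation (\<lambda>\<omega>. max (X \<omega> - a) 0 - max (X \<omega> - b) 0) = 0"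
    by (simp flip: expected_excess_difference_eq[OF int])
  then have "AE \<omega> in M. max (X \<omega> - a) 0 - max (X \<omega> - b) 0 = 0"
    using int \<open>a < b\<close> by (subst (asm) integral_nonneg_eq_0_iff_AE) auto
  then have "AE \<omega> in M. \<not> a < X \<omega>"
    by eventually_elim (use \<open>a < b\<close> in auto)
  then show False
    using tail by (simp add: AE_iff_measurable[OF _ refl])
qed

lemma (in prob_space) lipschitz_expected_excess:
  assumes int: "\<And>k. integrable M (\<lambda>\<omega>. max (X \<omega> - k) (0::real))"
  shows "1-lipschitz_on UNIV (expected_excess M X)"
proof (rule lipschitz_onI)
  fix a b :: real
  have "\<bar>expected_excess M X a - expected_excess M X b\<bar>
      \<le> expectation (\<lambda>\<omega>. \<bar>max (X \<omega> - a) 0 - max (X \<omega> - b) 0\<bar>)"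
    unfolding expected_excess_difference_eq[OF int] by (rule integral_abs_bound)
  also have "\<dots> \<le> expectation (\<lambda>_. \<bar>a - b\<bar>)"
    using int by (intro integral_mono) auto
  finally show "dist (expected_excess M X a) (expected_excess M X b) \<le> 1 * dist a b"
    by (simp add: dist_real_def prob_space)
qed simp

lemma emeasure_greater_neq_0_of_positive_density:
  fixes X :: "'a \<Rightarrow> real" and f :: "real \<Rightarrow> real"
  assumes dist: "distributed M lborel X (\<lambda>p. ennreal (f p))"
    and pos: "\<And>p. a < p \<Longrightarrow> 0 < f p"
  shows "emeasure M {\<omega> \<in> space M. a < X \<omega>} \<noteq> 0"
proof
  assume "emeasure M {\<omega> \<in> space M. a < X \<omega>} = 0"
  moreover have "X -` {a<..} \<inter> space M = {\<omega> \<in> space M. a < X \<omega>}"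
    by auto
  ultimately have "(\<integral>\<^sup>+p. ennreal (f p) * indicator {a<..} p \<partial>lborel) = 0"
    using distributed_emeasure[OF dist, of "{a<..}"] by simp
  moreover have [measurable]: "(\<lambda>p. ennreal (f p)) \<in> borel_measurable lborel"
    using dist by (rule distributed_borel_measurable)
  ultimately have "AE p in lborel. ennreal (f p) * indicator {a<..} p = 0"
    by (subst (asm) nn_integral_0_iff_AE) auto
  (* A bounded piece of the half-line suffices for the contradiction and has measure 1. *)
  then have "AE p in lborel. p \<notin> {a<..a + 1}"
    by eventually_elim (use pos in \<open>force simp: indicator_def split: if_splits\<close>)
  then have "emeasure lborel {a<..a + 1} = 0"
    by (subst (asm) AE_iff_measurable[of "{a<..a + 1}"]) auto
  then show False
    by simp
qed

section \<open>The certificate\<close>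

lemma conservative_certificate_at_or_above:
  assumes "c \<le> K"
  shows "conservative_certificate M c A \<phi> P K
    = (1 - \<phi>) * expected_excess M P c + \<phi> * expected_excess M P K - A"
  using assms by (auto simp: conservative_certificate_def algebra_simps)

text \<open>Below \<open>c\<close> the two distribution functions agree, so lowering the strike from \<open>c\<close> to \<open>K\<close>
  raises both expected excesses by the same amount and the bound is attained. Above \<open>c\<close> every tail
  keeps at least the fraction \<open>1 - \<phi>\<close>, and hence so does the expected excess between \<open>c\<close> and
  \<open>K\<close>.\<close>

lemma (in prob_space) conservative_certificate_le_incentive_value:
  fixes P Pw :: "'a \<Rightarrow> real"
  assumes meas: "P \<in> borel_measurable M"
    and int: "integrable M (\<lambda>\<omega>. max (P \<omega>) 0)"
    and "\<phi> \<le> 1"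
    and cp: "counterfactual_price M c \<phi> P Pw"
  shows "conservative_certificate M c A \<phi> P K \<le> incentive_value M c A P Pw K"
proof -
  have meas_w: "Pw \<in> borel_measurable M"
    and eq: "\<And>p. p < c \<Longrightarrow> distribution_function M Pw p = distribution_function M P p"
    and lower: "\<And>p. c \<le> p \<Longrightarrow>
      (1 - \<phi>) * (1 - distribution_function M P p) \<le> 1 - distribution_function M Pw p"
    and upper: "\<And>p. c \<le> p \<Longrightarrow> 1 - distribution_function M Pw p \<le> 1 - distribution_function M P p"
    using cp by (auto simp: counterfactual_price_def)
  have int_P: "integrable M (\<lambda>\<omega>. max (P \<omega> - k) 0)" for k
    using integrable_excess_shift[of P 0] int meas by simp
  have int_Pw: "integrable M (\<lambda>\<omega>. max (Pw \<omega> - k) 0)" for k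
    using integrable_excess_of_tail_le[OF meas meas_w int_P upper] .
  show ?thesis
  proof (cases "K \<le> c")
    case True
    have "expected_excess M Pw K - expected_excess M Pw c
        \<le> expected_excess M P K - expected_excess M P c"
      using expected_excess_difference_mono_tail[OF meas_w meas int_Pw int_P True, of 1] eq by simp
    then show ?thesis
      using True by (simp add: conservative_certificate_def incentive_value_def)
  next
    case False
    have "(1 - \<phi>) * (expected_excess M P c - expected_excess M P K)
        \<le> expected_excess M Pw c - expected_excess M Pw K"
      using expected_excess_difference_mono_tail[OF meas meas_w int_P int_Pw, of c K "1 - \<phi>"]
        lower \<open>\<phi> \<le> 1\<close> False by simp
    then show ?thesis
      using False by (simp add: conservative_certificate_def incentive_value_def algebra_simps)
  qed
qed

text \<open>Strict monotonicity separates the second case from the third: a zero at \<open>\<kappa>\<close> forces negative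
  values beyond \<open>\<kappa>\<close>. For \<open>\<phi> = 0\<close> the certificate is constant, so a zero is never unique and
  the whole half-line falls under one of the first two cases. The existence of a zero in the
  third case is the intermediate value theorem on \<open>{c..K}\<close>, where \<open>K\<close> is any strike with a
  negative value.\<close>

theorem proposition7:
  fixes M :: "'a measure" and P Pw :: "'a \<Rightarrow> real" and f :: "real \<Rightarrow> real" and c A \<phi> :: real
  assumes "prob_space M"
    and "c \<ge> 0" and "0 \<le> \<phi>" and "\<phi> \<le> 1"
    and "integrable M (\<lambda>\<omega>. max (P \<omega>) 0)"
    and "\<And>p. f p \<ge> 0"
    and "distributed M lborel P (\<lambda>p. ennreal (f p))"
    and "\<And>p. p > c \<Longrightarrow> f p > 0"
    and "counterfactual_price M c \<phi> P Pw"
  shows "let I = conservative_certificate M c A \<phi> P;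
             IC = incentive_compatible M c A P Pw;
             case1 = (\<forall>K\<ge>0. I K < 0);
             case2 = (\<forall>K\<ge>0. I K \<ge> 0);
             case3 = (\<exists>!\<kappa>. \<kappa> \<ge> c \<and> I \<kappa> = 0)
         in I constant_on {0..c} \<and>
            antimono_on {c<..} I \<and>
            (case1 \<or> case2 \<or> case3) \<and>
            \<not> (case1 \<and> case2) \<and> \<not> (case1 \<and> case3) \<and> \<not> (case2 \<and> case3) \<and>
            (case2 \<longrightarrow> (\<forall>K\<ge>0. IC K)) \<and>
            (case3 \<longrightarrow> \<phi> > 0 \<and> (\<forall>\<kappa>\<ge>c. I \<kappa> = 0 \<longrightarrow> (\<forall>K. 0 \<le> K \<and> K \<le> \<kappa> \<longrightarrow> IC K)))"
proof -
  interpret prob_space M by fact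
  have meas: "P \<in> borel_measurable M"
    using distributed_measurable[OF assms(7)] by simp
  have int: "integrable M (\<lambda>\<omega>. max (P \<omega> - k) 0)" for k
    using integrable_excess_shift[of P 0] assms(5) meas by simp
  define I where "I = conservative_certificate M c A \<phi> P"
  define IC where "IC = incentive_compatible M c A P Pw"
  have below: "I K = I c" if "K \<le> c" for K
    using that by (simp add: I_def conservative_certificate_def)
  have above: "I K = (1 - \<phi>) * expected_excess M P c + \<phi> * expected_excess M P K - A"
    if "c \<le> K" for K
    using that by (simp add: I_def conservative_certificate_at_or_above)
  have IC: "IC K" if "0 \<le> I K" for K
    using that conservative_certificate_le_incentive_value[OF meas assms(5,4,9), of A K]
    by (simp add: I_def IC_def incentive_compatible_def)
  have anti: "I L \<le> I K" if "K \<le> L" for K L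
  proof -
    have "I (max c L) \<le> I (max c K)"
      using that \<open>0 \<le> \<phi>\<close> by (simp add: above mult_left_mono expected_excess_antimono[OF int])
    then show ?thesis
      using below[of K] below[of L] by (auto simp: max_def split: if_splits)
  qed
  have strict: "I L < I K" if "0 < \<phi>" "c \<le> K" "K < L" for K L
  proof -
    have "expected_excess M P L < expected_excess M P K"
      using assms(8) that
      by (intro expected_excess_strict_antimono meas int
          emeasure_greater_neq_0_of_positive_density[OF assms(7)]) auto
    then show ?thesis
      using that by (simp add: above)
  qed
  have cont: "continuous_on {c..} I"
  proof -
    have "continuous_on {c..} (expected_excess M P)"
      using lipschitz_on_continuous_on[OF lipschitz_expected_excess[OF int]]
      by (rule continuous_on_subset) simp
    then have "continuous_on {c..}
        (\<lambda>K. (1 - \<phi>) * expected_excess M P c + \<phi> * expected_excess M P K - A)"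
      by (intro continuous_intros)
    then show ?thesis
      by (subst continuous_on_cong[OF refl above]) auto
  qed
  have const: "I K = I c" if "\<phi> = 0" for K
  proof (cases "K \<le> c")
    case True
    then show ?thesis by (rule below)
  next
    case False
    then show ?thesis using that by (simp add: above)
  qed
  have case3_pos: "0 < \<phi>" if case3: "\<exists>!\<kappa>. \<kappa> \<ge> c \<and> I \<kappa> = 0"
  proof (rule ccontr)
    assume "\<not> 0 < \<phi>"
    then have "\<phi> = 0" using \<open>0 \<le> \<phi>\<close> by simp
    obtain \<kappa> where \<kappa>: "c \<le> \<kappa>" "I \<kappa> = 0"
      and unique: "\<forall>x. c \<le> x \<and> I x = 0 \<longrightarrow> x = \<kappa>"
      using case3 by (elim ex1E conjE) (rule that)
    have "I (\<kappa> + 1) = 0"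
      using \<kappa>(2) const[OF \<open>\<phi> = 0\<close>, of \<kappa>] const[OF \<open>\<phi> = 0\<close>, of "\<kappa> + 1"] by simp
    moreover have "c \<le> \<kappa> + 1"
      using \<kappa> by simp
    ultimately have "\<kappa> + 1 = \<kappa>" using unique by blast
    then show False by simp
  qed
  have not23: "\<not> (\<forall>K\<ge>0. 0 \<le> I K)" if case3: "\<exists>!\<kappa>. \<kappa> \<ge> c \<and> I \<kappa> = 0"
  proof -
    obtain \<kappa> where "c \<le> \<kappa>" "I \<kappa> = 0" using case3 by (elim ex1E conjE) (rule that)
    then have "I (\<kappa> + 1) < 0" using strict[OF case3_pos[OF case3], of \<kappa> "\<kappa> + 1"] by simp
    moreover have "0 \<le> \<kappa> + 1" using \<open>c \<le> \<kappa>\<close> \<open>0 \<le> c\<close> by simp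
    ultimately show ?thesis by (meson not_le)
  qed
  have not13: "\<not> (\<forall>K\<ge>0. I K < 0)" if "\<exists>!\<kappa>. \<kappa> \<ge> c \<and> I \<kappa> = 0"
    using that \<open>0 \<le> c\<close> by (elim ex1E conjE) (metis less_irrefl order_trans)
  have trichotomy: "\<exists>!\<kappa>. \<kappa> \<ge> c \<and> I \<kappa> = 0"
    if not1: "\<not> (\<forall>K\<ge>0. I K < 0)" and not2: "\<not> (\<forall>K\<ge>0. 0 \<le> I K)"
  proof -
    obtain K0 where "0 \<le> I K0" using not1 by (meson not_le)
    then have "0 \<le> I c"
      using anti[of c K0] below[of K0] by linarith
    obtain K where "I K < 0" using not2 by (meson not_le)
    with \<open>0 \<le> I c\<close> have "c \<le> K" using below[of K] by linarith
    have "0 < \<phi>"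
      using const[of K] \<open>I K < 0\<close> \<open>0 \<le> I c\<close> \<open>0 \<le> \<phi>\<close> by linarith
    have "\<exists>\<kappa>. c \<le> \<kappa> \<and> \<kappa> \<le> K \<and> I \<kappa> = 0"
      using \<open>I K < 0\<close> \<open>0 \<le> I c\<close> \<open>c \<le> K\<close>
      by (intro IVT2' continuous_on_subset[OF cont]) auto
    then obtain \<kappa> where "c \<le> \<kappa>" "I \<kappa> = 0" by blast
    then show ?thesis
      using strict[OF \<open>0 < \<phi>\<close>] by (intro ex1I[of _ \<kappa>]) (simp, metis less_irrefl linorder_cases)
  qed
  have IC3: "IC K" if "I \<kappa> = 0" "K \<le> \<kappa>" for \<kappa> K
    using anti[OF that(2)] that(1) by (intro IC) simp
  have "I constant_on {0..c}"
    unfolding constant_on_def by (meson below atLeastAtMost_iff)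
  moreover have "antimono_on {c<..} I"
    by (intro monotone_onI anti)
  moreover have "\<not> ((\<forall>K\<ge>0. I K < 0) \<and> (\<forall>K\<ge>0. 0 \<le> I K))"
    by (meson linorder_not_less order_refl)
  ultimately show ?thesis
    unfolding Let_def I_def[symmetric] IC_def[symmetric]
  proof (intro conjI impI allI)
    show "(\<forall>K\<ge>0. I K < 0) \<or> (\<forall>K\<ge>0. 0 \<le> I K) \<or> (\<exists>!\<kappa>. \<kappa> \<ge> c \<and> I \<kappa> = 0)"
      using trichotomy by argo
    show "\<not> ((\<forall>K\<ge>0. I K < 0) \<and> (\<exists>!\<kappa>. \<kappa> \<ge> c \<and> I \<kappa> = 0))"
      using not13 by argo
    show "\<not> ((\<forall>K\<ge>0. 0 \<le> I K) \<and> (\<exists>!\<kappa>. \<kappa> \<ge> c \<and> I \<kappa> = 0))"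
      using not23 by argo
  qed (simp_all add: IC IC3 case3_pos)
qed

end
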